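(* Let $\mathcal{T},\mathcal{A}\in\Pi_3$. The partial integral equation (PIE) $\mathcal{T}\dot{\mathbf{x}}=\mathcal{A}\mathbf{x}$ is: (1) Exp. PIE to PDE stable if there exist $\mathcal{Q}\in\Pi_3$ and $\epsilon,\alpha>0$ such that $\mathcal{Q}\mathcal{T}=(\mathcal{Q}\mathcal{T})^*\ge\epsilon\mathcal{T}^*\mathcal{T}$ and $\mathcal{Q}\mathcal{A}+\mathcal{A}^*\mathcal{Q}^*\le-\alpha\mathcal{Q}\mathcal{T}$; (2) Exp. PIE stable if there exist $\mathcal{Q}\in\Pi_3$ and $\epsilon,\alpha>0$ such that $\mathcal{Q}\mathcal{T}=(\mathcal{Q}\mathcal{T})^*\ge\epsilon I$ and $\mathcal{Q}\mathcal{A}+\mathcal{A}^*\mathcal{Q}^*\le-\alpha\mathcal{Q}\mathcal{T}$; (3) Exp. PDE stable if there exist $\mathcal{P}=\mathcal{P}^*\in\Pi_3$ and $\epsilon,\alpha>0$ such that $\mathcal{P}\ge\epsilon I$ and $\mathcal{T}^*\mathcal{P}\mathcal{A}+\mathcal{A}^*\mathcal{P}\mathcal{T}\le-\alpha\mathcal{T}^*\mathcal{P}\mathcal{T}$; (4) Exp. PDE to PIE stable if there exist $\mathcal{Q}\in\Pi_3$ and $\epsilon,C,\alpha>0$ such that $\mathcal{Q}\mathcal{T}=(\mathcal{Q}\mathcal{T})^*\ge\epsilon I$, $\mathcal{Q}\mathcal{T}\le C\mathcal{T}^*\mathcal{T}$ and $\mathcal{Q}\mathcal{A}+\mathcal{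A}^*\mathcal{Q}^*\le-\alpha\mathcal{Q}\mathcal{T}$.
   Context: $L_2$ denotes the real Hilbert space $L_2([0,1];\mathbb{R}^m)$ with inner product $\langle\cdot,\cdot\rangle$ and norm $\|\cdot\|$. A partial integral (PI) operator is a bounded linear operator $\mathcal{P}:L_2\to L_2$ of the form $(\mathcal{P}\mathbf{x})(s)=R_0(s)\mathbf{x}(s)+\int_0^s R_1(s,\theta)\mathbf{x}(\theta)\,d\theta+\int_s^1R_2(s,\theta)\mathbf{x}(\theta)\,d\theta$ with (matrix-valued) $R_0\in L_\infty$ and $R_1,R_2\in L_2$; $\Pi_3$ is the set of all such operators. Adjoints $(\cdot)^*$ are with respect to the $L_2$ inner product, $I$ is the identity, and an operator inequality $\mathcal{M}\ge\mathcal{N}$ means $\langle\mathbf{x},\mathcal{M}\mathbf{x}\rangle\ge\langle\mathbf{x},\mathcal{N}\mathbf{x}\rangle$ for all $\mathbf{x}\in L_2$. A solution of $\mathcal{T}\dot{\mathbf{x}}=\mathcal{A}\mathbf{x}$ is a differentiable function $\mathbf{x}:[0,\infty)\to L_2$ with $\mathcal{T}\dot{\mathbf{x}}(t)=\mathcal{A}\mathbf{x}(t)$ for all $t\ge 0$. (When the PIE comes from a classically well-posed PDE, $\mathcal{T}\mathbf{x}(t)$ is the PDE state; this only motivates the terminology.) The PIE is called: - Exp. PIE to PDE stable if there are $C,\alpha>0$ such that every solution satisfies $\|\mathcal{T}\mathbf{x}(t)\|\le Ce^{-\alpha t}\|\mathbf{x}(0)\|$ for all $t\ge0$; - Exp.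 PIE stable if there are $C,\alpha>0$ such that every solution satisfies $\|\mathbf{x}(t)\|\le Ce^{-\alpha t}\|\mathbf{x}(0)\|$ for all $t\ge0$; - Exp. PDE stable if there are $C,\alpha>0$ such that every solution satisfies $\|\mathcal{T}\mathbf{x}(t)\|\le Ce^{-\alpha t}\|\mathcal{T}\mathbf{x}(0)\|$ for all $t\ge0$; - Exp. PDE to PIE stable if there are $C,\alpha>0$ such that every solution satisfies $\|\mathbf{x}(t)\|\le Ce^{-\alpha t}\|\mathcal{T}\mathbf{x}(0)\|$ for all $t\ge0$. The constants $C,\alpha$ in these stability definitions need not equal those in the operator inequalities. *)

theory Defs
  imports "HOL-Analysis.Analysis"
begin

abbreviation unit_measure :: "real measure"
  where "unit_measure \<equiv> restrict_space lborel {0..1}"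

definition square_integrable :: "'a measure \<Rightarrow> ('a \<Rightarrow> 'b::euclidean_space) \<Rightarrow> bool"
  where "square_integrable M f \<longleftrightarrow>
    f \<in> borel_measurable M \<and> integrable M (\<lambda>s. (norm (f s))\<^sup>2)"

lemma square_integrable_zero: "square_integrable M (\<lambda>_. 0)"
  by (simp add: square_integrable_def)

lemma square_integrable_scaleR:
  "square_integrable M f \<Longrightarrow> square_integrable M (\<lambda>s. c *\<^sub>R f s)"
  by (auto simp: square_integrable_def power_mult_distrib)

lemma square_integrable_add:
  assumes "square_integrable M f" "square_integrable M g"
  shows "square_integrable M (\<lambda>s. f s + g s)"
proof -
  have [measurable]: "f \<in> borel_measurable M" "g \<in> borel_measurable M"
    using assms by (auto simp: square_integrable_def)
  have "integrable M (\<lambda>s. 2 * (norm (f s))\<^sup>2 + 2 * (norm (g s))\<^sup>2)"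
    using assms by (simp add: square_integrable_def)
  then have "integrable M (\<lambda>s. (norm (f s + g s))\<^sup>2)"
  proof (rule Bochner_Integration.integrable_bound)
    show "AE s in M. norm ((norm (f s + g s))\<^sup>2) \<le> norm (2 * (norm (f s))\<^sup>2 + 2 * (norm (g s))\<^sup>2)"
    proof (rule AE_I2)
      fix s
      have "(norm (f s + g s))\<^sup>2 \<le> (norm (f s) + norm (g s))\<^sup>2"
        by (simp add: norm_triangle_ineq power_mono)
      also have "\<dots> \<le> 2 * (norm (f s))\<^sup>2 + 2 * (norm (g s))\<^sup>2"
        using sum_squares_bound[of "norm (f s)" "norm (g s)"]
        by (simp add: power2_sum)
      finally show "norm ((norm (f s + g s))\<^sup>2) \<le> norm (2 * (norm (f s))\<^sup>2 + 2 * (norm (g s))\<^sup>2)"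
        by simp
    qed
  qed measurable
  then show ?thesis
    by (simp add: square_integrable_def)
qed

lemma integrable_inner_square_integrable:
  assumes "square_integrable M f" "square_integrable M g"
  shows "integrable M (\<lambda>s. f s \<bullet> g s)"
proof -
  have [measurable]: "f \<in> borel_measurable M" "g \<in> borel_measurable M"
    using assms by (auto simp: square_integrable_def)
  have "integrable M (\<lambda>s. (norm (f s))\<^sup>2 + (norm (g s))\<^sup>2)"
    using assms by (simp add: square_integrable_def)
  then show ?thesis
  proof (rule Bochner_Integration.integrable_bound)
    show "AE s in M. norm (f s \<bullet> g s) \<le> norm ((norm (f s))\<^sup>2 + (norm (g s))\<^sup>2)"
    proof (rule AE_I2)
      fix s
      have "\<bar>f s \<bullet> g s\<bar> \<le> norm (f s) * norm (g s)"
        by (rule Cauchy_Schwarz_ineq2)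
      also have "\<dots> \<le> 2 * norm (f s) * norm (g s)"
        by simp
      also have "\<dots> \<le> (norm (f s))\<^sup>2 + (norm (g s))\<^sup>2"
        by (rule sum_squares_bound)
      finally show "norm (f s \<bullet> g s) \<le> norm ((norm (f s))\<^sup>2 + (norm (g s))\<^sup>2)"
        by simp
    qed
  qed measurable
qed

definition L2_rel :: "(real \<Rightarrow> real^'m) \<Rightarrow> (real \<Rightarrow> real^'m) \<Rightarrow> bool"
  where "L2_rel f g \<longleftrightarrow> square_integrable unit_measure f \<and> square_integrable unit_measure g
    \<and> (AE s in unit_measure. f s = g s)"

quotient_type 'm L2 = "real \<Rightarrow> real^'m::finite" / partial: L2_rel
proof (rule part_equivpI)
  show "\<exists>f. L2_rel f (f :: real \<Rightarrow> real^'m)"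
    using square_integrable_zero by (auto simp: L2_rel_def)
  show "symp (L2_rel :: (real \<Rightarrow> real^'m) \<Rightarrow> _)"
    by (auto simp: symp_def L2_rel_def)
  show "transp (L2_rel :: (real \<Rightarrow> real^'m) \<Rightarrow> _)"
    by (auto simp: transp_def L2_rel_def elim: AE_mp)
qed

instantiation L2 :: (finite) real_inner
begin

lift_definition zero_L2 :: "'a L2" is "\<lambda>_. 0"
  by (simp add: L2_rel_def square_integrable_zero)

lift_definition plus_L2 :: "'a L2 \<Rightarrow> 'a L2 \<Rightarrow> 'a L2" is "\<lambda>f g s. f s + g s"
  by (auto simp: L2_rel_def square_integrable_add)

lift_definition scaleR_L2 :: "real \<Rightarrow> 'a L2 \<Rightarrow> 'a L2" is "\<lambda>c f s. c *\<^sub>R f s"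
  by (auto simp: L2_rel_def square_integrable_scaleR)

lift_definition inner_L2 :: "'a L2 \<Rightarrow> 'a L2 \<Rightarrow> real"
  is "\<lambda>f g. \<integral>s. f s \<bullet> g s \<partial>unit_measure"
  by (rule integral_cong_AE)
    (auto simp: L2_rel_def square_integrable_def)

definition uminus_L2 :: "'a L2 \<Rightarrow> 'a L2" where "uminus_L2 x = (- 1) *\<^sub>R x"
definition minus_L2 :: "'a L2 \<Rightarrow> 'a L2 \<Rightarrow> 'a L2" where "minus_L2 x y = x + - y"
definition norm_L2 :: "'a L2 \<Rightarrow> real" where "norm_L2 x = sqrt (x \<bullet> x)"
definition dist_L2 :: "'a L2 \<Rightarrow> 'a L2 \<Rightarrow> real" where "dist_L2 x y = norm (x - y)"
definition sgn_L2 :: "'a L2 \<Rightarrow> 'a L2" where "sgn_L2 x = inverse (norm x) *\<^sub>R x"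
definition uniformity_L2 :: "('a L2 \<times> 'a L2) filter"
  where "uniformity_L2 = (INF e\<in>{0<..}. principal {(x, y). dist x y < e})"
definition open_L2 :: "'a L2 set \<Rightarrow> bool"
  where "open_L2 U = (\<forall>x\<in>U. \<forall>\<^sub>F (x', y) in uniformity. x' = x \<longrightarrow> y \<in> U)"

instance
proof
  fix x y z :: "'a L2" and a b :: real
  show "x + y + z = x + (y + z)"
    by transfer (auto simp: L2_rel_def square_integrable_add add.assoc)
  show "x + y = y + x"
    by transfer (auto simp: L2_rel_def square_integrable_add add.commute)
  show "0 + x = x"
    by transfer (auto simp: L2_rel_def)
  show "- x + x = 0"
    unfolding uminus_L2_def
    by transfer (auto simp: L2_rel_def square_integrable_zero)
  show "x - y = x + - y"
    by (rule minus_L2_def)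
  show "a *\<^sub>R (x + y) = a *\<^sub>R x + a *\<^sub>R y"
    by transfer (auto simp: L2_rel_def square_integrable_add square_integrable_scaleR
        scaleR_right_distrib)
  show "(a + b) *\<^sub>R x = a *\<^sub>R x + b *\<^sub>R x"
    by transfer (auto simp: L2_rel_def square_integrable_add square_integrable_scaleR
        scaleR_left_distrib)
  show "a *\<^sub>R b *\<^sub>R x = (a * b) *\<^sub>R x"
    by transfer (auto simp: L2_rel_def square_integrable_scaleR)
  show "1 *\<^sub>R x = x"
    by transfer (auto simp: L2_rel_def)
  show "dist x y = norm (x - y)"
    by (rule dist_L2_def)
  show "sgn x = inverse (norm x) *\<^sub>R x"
    by (rule sgn_L2_def)
  show "uniformity = (INF e\<in>{0<..}. principal {(x :: 'a L2, y). dist x y < e})"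
    by (rule uniformity_L2_def)
  show "open U = (\<forall>x\<in>U. \<forall>\<^sub>F (x', y) in uniformity. x' = x \<longrightarrow> y \<in> U)" for U :: "'a L2 set"
    by (rule open_L2_def)
  show "x \<bullet> y = y \<bullet> x"
    by transfer (simp add: inner_commute)
  show "(x + y) \<bullet> z = x \<bullet> z + y \<bullet> z"
    by transfer (simp add: L2_rel_def inner_add_left integrable_inner_square_integrable)
  show "a *\<^sub>R x \<bullet> y = a * (x \<bullet> y)"
    by transfer simp
  show "0 \<le> x \<bullet> x"
    by transfer simp
  show "(x \<bullet> x = 0) = (x = 0)"
  proof transfer
    fix f :: "real \<Rightarrow> real^'a"
    assume "L2_rel f f"
    then have f: "square_integrable unit_measure f"
      by (simp add: L2_rel_def)
    have "((\<integral>s. f s \<bullet> f s \<partial>unit_measure) = 0) = (AE s in unit_measure. f s \<bullet> f s = 0)"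
      by (rule integral_nonneg_eq_0_iff_AE) (use integrable_inner_square_integrable[OF f f] in auto)
    also have "\<dots> = L2_rel f (\<lambda>_. 0)"
      by (simp add: L2_rel_def f square_integrable_zero)
    finally show "((\<integral>s. f s \<bullet> f s \<partial>unit_measure) = 0) = L2_rel f (\<lambda>_. 0)" .
  qed
  show "norm x = sqrt (x \<bullet> x)"
    by (rule norm_L2_def)
qed

end

text \<open>
  The kernels are square-integrable on the whole square; only their values for
  \<open>\<theta> \<le> s\<close> and \<open>s \<le> \<theta>\<close>, respectively, matter. The identity is required almost everywhere,
  and so does not depend on the representatives chosen by \<^const>\<open>rep_L2\<close>.
  Every such operator has an \<open>L\<^sub>2\<close> adjoint, obtained by transposing and swapping the kernels, so the
  choice in the definition of \<^const>\<open>adjoint\<close> is never vacuous for these operators and their products.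
\<close>

definition PI_operators :: "('m::finite L2 \<Rightarrow> 'm L2) set"  (\<open>\<Pi>\<^sub>3\<close>)
  where "\<Pi>\<^sub>3 = {P. bounded_linear P \<and>
    (\<exists>(R0 :: real \<Rightarrow> real^'m^'m) (R1 :: real \<Rightarrow> real \<Rightarrow> real^'m^'m) (R2 :: real \<Rightarrow> real \<Rightarrow> real^'m^'m).
      R0 \<in> borel_measurable unit_measure \<and> (\<exists>B. AE s in unit_measure. norm (R0 s) \<le> B) \<and>
      square_integrable (unit_measure \<Otimes>\<^sub>M unit_measure) (\<lambda>(s, \<theta>). R1 s \<theta>) \<and>
      square_integrable (unit_measure \<Otimes>\<^sub>M unit_measure) (\<lambda>(s, \<theta>). R2 s \<theta>) \<and>
      (\<forall>x. AE s in unit_measure.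
        rep_L2 (P x) s = R0 s *v rep_L2 x s
          + (LINT \<theta>:{0..s}|lborel. R1 s \<theta> *v rep_L2 x \<theta>)
          + (LINT \<theta>:{s..1}|lborel. R2 s \<theta> *v rep_L2 x \<theta>)))}"

definition op_le :: "('a::real_inner \<Rightarrow> 'a) \<Rightarrow> ('a \<Rightarrow> 'a) \<Rightarrow> bool"  (infix \<open>\<preceq>\<close> 50)
  where "M \<preceq> N \<longleftrightarrow> (\<forall>x. x \<bullet> M x \<le> x \<bullet> N x)"

text \<open>The time derivative at \<open>0\<close> is one-sided; values at negative times are irrelevant.\<close>

definition PIE_solution :: "('a::real_normed_vector \<Rightarrow> 'a) \<Rightarrow> ('a \<Rightarrow> 'a) \<Rightarrow> (real \<Rightarrow> 'a) \<Rightarrow> bool"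
  where "PIE_solution T A x \<longleftrightarrow> x differentiable_on {0..} \<and>
    (\<forall>t\<ge>0. T (vector_derivative x (at t within {0..})) = A (x t))"

definition exp_PIE_to_PDE_stable :: "('a::real_normed_vector \<Rightarrow> 'a) \<Rightarrow> ('a \<Rightarrow> 'a) \<Rightarrow> bool"
  where "exp_PIE_to_PDE_stable T A \<longleftrightarrow> (\<exists>C>0. \<exists>\<alpha>>0. \<forall>x. PIE_solution T A x \<longrightarrow>
    (\<forall>t\<ge>0. norm (T (x t)) \<le> C * exp (- \<alpha> * t) * norm (x 0)))"

definition exp_PIE_stable :: "('a::real_normed_vector \<Rightarrow> 'a) \<Rightarrow> ('a \<Rightarrow> 'a) \<Rightarrow> bool"
  where "exp_PIE_stable T A \<longleftrightarrow> (\<exists>C>0. \<exists>\<alpha>>0. \<forall>x. PIE_solution T A x \<longrightarrow>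
    (\<forall>t\<ge>0. norm (x t) \<le> C * exp (- \<alpha> * t) * norm (x 0)))"

definition exp_PDE_stable :: "('a::real_normed_vector \<Rightarrow> 'a) \<Rightarrow> ('a \<Rightarrow> 'a) \<Rightarrow> bool"
  where "exp_PDE_stable T A \<longleftrightarrow> (\<exists>C>0. \<exists>\<alpha>>0. \<forall>x. PIE_solution T A x \<longrightarrow>
    (\<forall>t\<ge>0. norm (T (x t)) \<le> C * exp (- \<alpha> * t) * norm (T (x 0))))"

definition exp_PDE_to_PIE_stable :: "('a::real_normed_vector \<Rightarrow> 'a) \<Rightarrow> ('a \<Rightarrow> 'a) \<Rightarrow> bool"
  where "exp_PDE_to_PIE_stable T A \<longleftrightarrow> (\<exists>C>0. \<exists>\<alpha>>0. \<forall>x. PIE_solution T A x \<longrightarrow>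
    (\<forall>t\<ge>0. norm (x t) \<le> C * exp (- \<alpha> * t) * norm (T (x 0))))"

end

theory Submission
  imports Defs
begin

text \<open>
  All four criteria are Lyapunov arguments with a quadratic functional \<open>V\<close>. In (1), (2) and (4) one
  takes \<open>V(\<^bold>x) = \<langle>\<^bold>x, \<Q>\<T>\<^bold>x\<rangle>\<close>. Because \<open>\<Q>\<T>\<close> is self-adjoint, along a solution
  \<open>V' = 2\<langle>\<^bold>x, \<Q>\<T>\<^bold>x'\<rangle> = 2\<langle>\<^bold>x, \<Q>\<A>\<^bold>x\<rangle> = \<langle>\<^bold>x, \<Q>\<A>\<^bold>x + \<A>\<^sup>*\<Q>\<^sup>*\<^bold>x\<rangle> \<le> -\<alpha>V\<close>, so \<open>V\<close> decays like
  \<open>exp(-\<alpha>t)\<close>. In (3) the same computation is made for \<open>V(\<^bold>x) = \<langle>\<T>\<^bold>x, \<P>\<T>\<^bold>x\<rangle>\<close>, following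
  \<open>\<^bold>z = \<T>\<^bold>x\<close> with \<open>\<^bold>z' = \<A>\<^bold>x\<close>. The lower operator bound gives \<open>\<epsilon>\<parallel>u(t)\<parallel>\<^sup>2 \<le> V(\<^bold>x(t))\<close> for the quantity \<open>u\<close>
  to be estimated, and \<open>V(\<^bold>x(0))\<close> is bounded above by boundedness of the operator, or by the
  assumption \<open>\<Q>\<T> \<le> C\<T>\<^sup>*\<T>\<close> in (4). Square roots halve the decay rate. The two decay statements are
  \<open>PIE_state_lyapunov_decay\<close> and \<open>PDE_state_lyapunov_decay\<close>.

  The computation uses the defining identity of \<^const>\<open>adjoint\<close> for \<open>\<T>\<close>, \<open>\<A>\<close>, \<open>\<Q>\<close> and \<open>\<Q>\<T>\<close>. Since
  \<^const>\<open>adjoint\<close> is a choice, this identity holds only once some adjoint is known to exist; this is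
  \<open>PI_operator_has_adjoint\<close>. The adjoint is written down explicitly: a partial integral operator is the
  sum of a bounded multiplication operator, whose matrices are transposed, and of two integral
  operators with square-integrable kernels, whose kernels are transposed and have their arguments
  exchanged. Fubini's theorem verifies the identity, and Cauchy--Schwarz shows that the
  transposed operators map square-integrable functions to square-integrable functions.
\<close>

section \<open>Pairs of formally adjoint operators\<close>

text \<open>
  Adjointness at the level of functions rather than equivalence classes: \<open>F\<close> and \<open>G\<close> act on
  representatives, so that the summands of a partial integral operator can be treated one at a time
  before passing to the quotient.
\<close>

definition formal_adjoints ::
  "'s measure \<Rightarrow> (('s \<Rightarrow> 'a::euclidean_space) \<Rightarrow> 's \<Rightarrow> 'b::euclidean_space) \<Rightarrow> (('s \<Rightarrow> 'b) \<Rightarrow> 's \<Rightarrow> 'a) \<Rightarrow> bool"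
  where "formal_adjoints M F G \<longleftrightarrow>
    (\<forall>f. square_integrable M f \<longrightarrow> square_integrable M (F f)) \<and>
    (\<forall>g. square_integrable M g \<longrightarrow> square_integrable M (G g)) \<and>
    (\<forall>f g. square_integrable M f \<longrightarrow> square_integrable M g \<longrightarrow>
      (\<integral>s. F f s \<bullet> g s \<partial>M) = (\<integral>s. f s \<bullet> G g s \<partial>M))"

lemma formal_adjoints_add:
  assumes "formal_adjoints M F G" "formal_adjoints M F' G'"
  shows "formal_adjoints M (\<lambda>f s. F f s + F' f s) (\<lambda>g s. G g s + G' g s)"
  using assms unfolding formal_adjoints_def
  by (simp add: square_integrable_add inner_add_left inner_add_right
      integrable_inner_square_integrable)

lemma square_integrable_if_norm_le:
  fixes h :: "'a \<Rightarrow> 'b::euclidean_space" and f :: "'a \<Rightarrow> 'c::euclidean_space"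
  assumes "square_integrable M f" "h \<in> borel_measurable M"
    and "AE s in M. norm (h s) \<le> c * norm (f s)"
  shows "square_integrable M h"
  unfolding square_integrable_def
proof
  show [measurable]: "h \<in> borel_measurable M" by fact
  have "integrable M (\<lambda>s. c\<^sup>2 * (norm (f s))\<^sup>2)"
    using assms(1) by (simp add: square_integrable_def)
  then show "integrable M (\<lambda>s. (norm (h s))\<^sup>2)"
  proof (rule Bochner_Integration.integrable_bound)
    show "AE s in M. norm ((norm (h s))\<^sup>2) \<le> norm (c\<^sup>2 * (norm (f s))\<^sup>2)"
      using assms(3)
    proof eventually_elim
      case (elim s)
      then have "(norm (h s))\<^sup>2 \<le> (c * norm (f s))\<^sup>2"
        by (intro power_mono) auto
      then show ?case by (simp add: power_mult_distrib)
    qed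
  qed measurable
qed

section \<open>Matrices acting from either side\<close>

text \<open>
  A matrix kernel acts by \<open>A *v x\<close>, its transpose by \<open>y v* A\<close>. Treating both as bounded bilinear maps
  lets an operator and its transpose share one set of integrability estimates.
\<close>

lemma borel_measurable_bounded_bilinear:
  fixes prod :: "'k::euclidean_space \<Rightarrow> 'v::euclidean_space \<Rightarrow> 'w::euclidean_space"
  assumes prod: "bounded_bilinear prod" and f: "f \<in> borel_measurable M" and g: "g \<in> borel_measurable M"
  shows "(\<lambda>s. prod (f s) (g s)) \<in> borel_measurable M"
proof (rule borel_measurable_continuous_Pair[OF f g])
  show "continuous_on UNIV (\<lambda>x. prod (fst x) (snd x))"
    by (intro bounded_bilinear.continuous_on[OF prod] continuous_on_fst continuous_on_snd continuous_on_id)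
qed

lemma norm_matrix_vector_mult_le:
  fixes A :: "real^'n^'m"
  shows "norm (A *v x) \<le> norm A * norm x"
proof -
  have "norm (A *v x) = L2_set (\<lambda>i. norm (A $ i \<bullet> x)) UNIV"
    unfolding norm_vec_def by (simp add: matrix_vector_mul_component)
  also have "\<dots> \<le> L2_set (\<lambda>i. norm (A $ i) * norm x) UNIV"
    by (rule L2_set_mono) (auto simp: Cauchy_Schwarz_ineq2)
  also have "\<dots> = norm A * norm x"
    by (simp add: norm_vec_def L2_set_left_distrib)
  finally show ?thesis .
qed

lemma bounded_bilinear_matrix_vector_mult:
  "bounded_bilinear ((*v) :: real^'n^'m \<Rightarrow> _)"
proof
  show "\<exists>K. \<forall>(A::real^'n^'m) x. norm (A *v x) \<le> norm A * norm x * K"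
    using norm_matrix_vector_mult_le by (intro exI[of _ 1]) auto
qed (simp_all add: matrix_vector_right_distrib matrix_vector_mult_add_rdistrib
      matrix_vector_mult_scaleR scaleR_matrix_vector_assoc)

text \<open>
  The bound for the transposed action is obtained by duality, from
  \<open>\<parallel>A\<^sup>Ty\<parallel>\<^sup>2 = \<langle>y, AA\<^sup>Ty\<rangle> \<le> \<parallel>y\<parallel> \<parallel>A\<parallel> \<parallel>A\<^sup>Ty\<parallel>\<close>.
\<close>
lemma bounded_bilinear_vector_matrix_mult:
  "bounded_bilinear (\<lambda>(A::real^'n^'m) y. y v* A)"
proof
  have "norm (y v* A) \<le> norm A * norm y" for A :: "real^'n^'m" and y
  proof -
    have "norm (y v* A) * norm (y v* A) = y \<bullet> (A *v (y v* A))"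
      by (metis dot_lmul_matrix power2_eq_square power2_norm_eq_inner)
    also have "\<dots> \<le> norm y * (norm A * norm (y v* A))"
      by (meson norm_matrix_vector_mult_le mult_left_mono norm_ge_zero norm_cauchy_schwarz order_trans)
    finally show ?thesis
      by (cases "y v* A = 0") (auto simp: mult_ac)
  qed
  then show "\<exists>K. \<forall>(A::real^'n^'m) y. norm (y v* A) \<le> norm A * norm y * K"
    by (intro exI[of _ 1]) auto
qed (simp_all add: vector_matrix_mult_def vec_eq_iff algebra_simps sum.distrib sum_distrib_left)

section \<open>Integral operators with square-integrable kernels\<close>

lemma mult_le_sum_squares: "a * b \<le> a\<^sup>2 + b\<^sup>2" for a b :: real
proof (cases "0 \<le> a * b")
  case True
  then show ?thesis using sum_squares_bound[of a b] by linarith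
next
  case False
  then show ?thesis using zero_le_power2[of a] zero_le_power2[of b] by linarith
qed

context pair_sigma_finite
begin

context
  fixes prod :: "'k::euclidean_space \<Rightarrow> 'v::euclidean_space \<Rightarrow> 'w::euclidean_space"
    and K :: "'a \<times> 'b \<Rightarrow> 'k" and f :: "'b \<Rightarrow> 'v"
  assumes prod: "bounded_bilinear prod"
    and K: "square_integrable (M1 \<Otimes>\<^sub>M M2) K" and f: "square_integrable M2 f"
begin

interpretation bounded_bilinear prod by (rule prod)

text \<open>
  By Fubini, almost every section of \<open>K\<close> is square integrable, and a product of square-integrable
  functions is integrable. This lets inner products be pulled out of the inner integral below.
\<close>
lemma integrable_kernel_section:
  "AE s in M1. integrable M2 (\<lambda>\<theta>. prod (K (s, \<theta>)) (f \<theta>))"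
proof -
  have [measurable]: "K \<in> borel_measurable (M1 \<Otimes>\<^sub>M M2)" "f \<in> borel_measurable M2"
    using K f by (auto simp: square_integrable_def)
  obtain c where c: "c > 0" "\<And>k v. norm (prod k v) \<le> norm k * norm v * c"
    using pos_bounded by blast
  have "AE s in M1. integrable M2 (\<lambda>\<theta>. (norm (K (s, \<theta>)))\<^sup>2)"
    using K by (intro AE_integrable_fst') (simp add: square_integrable_def)
  then show ?thesis
    using AE_space
  proof eventually_elim
    case (elim s)
    have [measurable]: "(\<lambda>\<theta>. prod (K (s, \<theta>)) (f \<theta>)) \<in> borel_measurable M2"
      using elim(2) by (intro borel_measurable_bounded_bilinear[OF prod]) measurable
    have "integrable M2 (\<lambda>\<theta>. c * ((norm (K (s, \<theta>)))\<^sup>2 + (norm (f \<theta>))\<^sup>2))"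
      using elim f by (simp add: square_integrable_def)
    then show ?case
    proof (rule Bochner_Integration.integrable_bound)
      show "AE \<theta> in M2. norm (prod (K (s, \<theta>)) (f \<theta>)) \<le> norm (c * ((norm (K (s, \<theta>)))\<^sup>2 + (norm (f \<theta>))\<^sup>2))"
      proof (rule AE_I2)
        fix \<theta>
        have "norm (K (s, \<theta>)) * norm (f \<theta>) \<le> (norm (K (s, \<theta>)))\<^sup>2 + (norm (f \<theta>))\<^sup>2"
          by (rule mult_le_sum_squares)
        then show "norm (prod (K (s, \<theta>)) (f \<theta>)) \<le> norm (c * ((norm (K (s, \<theta>)))\<^sup>2 + (norm (f \<theta>))\<^sup>2))"
          using c(2)[of "K (s, \<theta>)" "f \<theta>"] c(1)
          by (simp add: mult.commute[of c] order_trans[OF _ mult_right_mono])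
      qed
    qed measurable
  qed
qed

text \<open>
  This is the Hilbert--Schmidt bound: Cauchy--Schwarz in the inner variable estimates the square of
  the norm at \<open>s\<close> by \<open>c\<^sup>2 \<parallel>f\<parallel>\<^sup>2 \<integral>\<parallel>K(s, \<theta>)\<parallel>\<^sup>2 d\<theta>\<close>, whose integral over \<open>s\<close> is finite. Extended
  nonnegative integrals make the estimate valid for every \<open>s\<close>: where the section is not integrable,
  the Bochner integral is zero and the bound holds trivially.
\<close>
lemma square_integrable_kernel_operator:
  "square_integrable M1 (\<lambda>s. \<integral>\<theta>. prod (K (s, \<theta>)) (f \<theta>) \<partial>M2)"
proof -
  have [measurable]: "K \<in> borel_measurable (M1 \<Otimes>\<^sub>M M2)" "f \<in> borel_measurable M2"
    using K f by (auto simp: square_integrable_def)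
  have [measurable]: "(\<lambda>(s, \<theta>). prod (K (s, \<theta>)) (f \<theta>)) \<in> borel_measurable (M1 \<Otimes>\<^sub>M M2)"
    unfolding case_prod_beta by (intro borel_measurable_bounded_bilinear[OF prod]) measurable
  obtain c where c: "c > 0" "\<And>k v. norm (prod k v) \<le> norm k * norm v * c"
    using pos_bounded by blast
  define F where "F = (\<integral>\<^sup>+\<theta>. (ennreal (norm (f \<theta>)))\<^sup>2 \<partial>M2)"
  have F: "F < \<infinity>"
    using f by (auto simp: F_def square_integrable_def integrable_iff_bounded ennreal_power)
  define h where "h s = (\<integral>\<theta>. prod (K (s, \<theta>)) (f \<theta>) \<partial>M2)" for s
  have [measurable]: "h \<in> borel_measurable M1"
    unfolding h_def by measurable
  have bound: "ennreal ((norm (h s))\<^sup>2) \<le> ennreal (c\<^sup>2) * F * (\<integral>\<^sup>+\<theta>. (ennreal (norm (K (s, \<theta>))))\<^sup>2 \<partial>M2)"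
    if s: "s \<in> space M1" for s
  proof -
    have [measurable]: "(\<lambda>\<theta>. K (s, \<theta>)) \<in> borel_measurable M2"
      using s by measurable
    have "ennreal (norm (h s)) \<le> (\<integral>\<^sup>+\<theta>. norm (prod (K (s, \<theta>)) (f \<theta>)) \<partial>M2)"
      unfolding h_def
      by (cases "integrable M2 (\<lambda>\<theta>. prod (K (s, \<theta>)) (f \<theta>))")
        (auto simp: integral_norm_bound_ennreal not_integrable_integral_eq)
    also have "\<dots> \<le> (\<integral>\<^sup>+\<theta>. ennreal c * (ennreal (norm (K (s, \<theta>))) * ennreal (norm (f \<theta>))) \<partial>M2)"
      using c by (intro nn_integral_mono)
        (auto simp: mult.commute[of c] less_imp_le simp flip: ennreal_mult)
    also have "\<dots> = ennreal c * (\<integral>\<^sup>+\<theta>. ennreal (norm (K (s, \<theta>))) * ennreal (norm (f \<theta>)) \<partial>M2)"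
      by (rule nn_integral_cmult) measurable
    finally have "(ennreal (norm (h s)))\<^sup>2 \<le>
        (ennreal c * (\<integral>\<^sup>+\<theta>. ennreal (norm (K (s, \<theta>))) * ennreal (norm (f \<theta>)) \<partial>M2))\<^sup>2"
      by (rule power_mono) simp
    also have "\<dots> = (ennreal c)\<^sup>2 * (\<integral>\<^sup>+\<theta>. ennreal (norm (K (s, \<theta>))) * ennreal (norm (f \<theta>)) \<partial>M2)\<^sup>2"
      by (rule power_mult_distrib)
    also have "\<dots> \<le> (ennreal c)\<^sup>2 * ((\<integral>\<^sup>+\<theta>. (ennreal (norm (K (s, \<theta>))))\<^sup>2 \<partial>M2) * F)"
      unfolding F_def by (intro mult_left_mono Cauchy_Schwarz_nn_integral) auto
    finally show ?thesis
      using c(1) by (simp add: ennreal_power mult_ac)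
  qed
  have "(\<integral>\<^sup>+s. ennreal ((norm (h s))\<^sup>2) \<partial>M1) \<le>
      (\<integral>\<^sup>+s. ennreal (c\<^sup>2) * F * (\<integral>\<^sup>+\<theta>. (ennreal (norm (K (s, \<theta>))))\<^sup>2 \<partial>M2) \<partial>M1)"
    by (intro nn_integral_mono bound)
  also have "\<dots> = ennreal (c\<^sup>2) * F * (\<integral>\<^sup>+s. (\<integral>\<^sup>+\<theta>. (ennreal (norm (K (s, \<theta>))))\<^sup>2 \<partial>M2) \<partial>M1)"
    by (intro nn_integral_cmult) measurable
  also have "(\<integral>\<^sup>+s. (\<integral>\<^sup>+\<theta>. (ennreal (norm (K (s, \<theta>))))\<^sup>2 \<partial>M2) \<partial>M1) =
      (\<integral>\<^sup>+p. (ennreal (norm (K p)))\<^sup>2 \<partial>(M1 \<Otimes>\<^sub>M M2))"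
    by (rule M2.nn_integral_fst) measurable
  also have "ennreal (c\<^sup>2) * F * \<dots> < \<infinity>"
    using F K by (auto simp: square_integrable_def integrable_iff_bounded ennreal_power
        intro!: ennreal_mult_less_top[THEN iffD2])
  finally have "integrable M1 (\<lambda>s. (norm (h s))\<^sup>2)"
    by (simp add: integrable_iff_bounded)
  then show ?thesis
    by (simp add: square_integrable_def flip: h_def)
qed

text \<open>
  Fubini's theorem applies to \<open>prod (K (s, \<theta>)) (f \<theta>) \<bullet> g s\<close> because it is dominated by a multiple of
  \<open>\<parallel>K(s, \<theta>)\<parallel>\<^sup>2 + \<parallel>g(s)\<parallel>\<^sup>2 \<parallel>f(\<theta>)\<parallel>\<^sup>2\<close>, and exchanging the integrals moves the kernel to the other side of
  the inner product.
\<close>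
lemma integral_kernel_operator_inner:
  fixes prod' :: "'k \<Rightarrow> 'w \<Rightarrow> 'v" and g :: "'a \<Rightarrow> 'w"
  assumes prod': "bounded_bilinear prod'" "\<And>k v w. prod k v \<bullet> w = v \<bullet> prod' k w"
    and g: "square_integrable M1 g"
    and section': "AE \<theta> in M2. integrable M1 (\<lambda>s. prod' (K (s, \<theta>)) (g s))"
  shows "(\<integral>s. (\<integral>\<theta>. prod (K (s, \<theta>)) (f \<theta>) \<partial>M2) \<bullet> g s \<partial>M1) =
    (\<integral>\<theta>. f \<theta> \<bullet> (\<integral>s. prod' (K (s, \<theta>)) (g s) \<partial>M1) \<partial>M2)"
proof -
  interpret prod': bounded_bilinear prod' by fact
  have [measurable]: "K \<in> borel_measurable (M1 \<Otimes>\<^sub>M M2)" "f \<in> borel_measurable M2"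
      "g \<in> borel_measurable M1"
    using K f g by (auto simp: square_integrable_def)
  have [measurable]: "(\<lambda>(s, \<theta>). prod (K (s, \<theta>)) (f \<theta>)) \<in> borel_measurable (M1 \<Otimes>\<^sub>M M2)"
    unfolding case_prod_beta by (intro borel_measurable_bounded_bilinear[OF prod]) measurable
  have [measurable]: "(\<lambda>(\<theta>, s). prod' (K (s, \<theta>)) (g s)) \<in> borel_measurable (M2 \<Otimes>\<^sub>M M1)"
    unfolding case_prod_beta by (intro borel_measurable_bounded_bilinear[OF prod'(1)]) measurable
  obtain c where c: "c > 0" "\<And>k v. norm (prod k v) \<le> norm k * norm v * c"
    using pos_bounded by blast
  define J where "J = (\<lambda>(s, \<theta>). prod (K (s, \<theta>)) (f \<theta>) \<bullet> g s)"
  have [measurable]: "J \<in> borel_measurable (M1 \<Otimes>\<^sub>M M2)"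
    unfolding J_def by measurable
  have gf: "integrable (M1 \<Otimes>\<^sub>M M2) (\<lambda>(s, \<theta>). (norm (g s))\<^sup>2 * (norm (f \<theta>))\<^sup>2)"
    using f g by (intro Fubini_integrable)
      (auto simp: square_integrable_def)
  have J: "integrable (M1 \<Otimes>\<^sub>M M2) J"
  proof (rule Bochner_Integration.integrable_bound)
    show "integrable (M1 \<Otimes>\<^sub>M M2)
        (\<lambda>p. c * ((norm (K p))\<^sup>2 + (case p of (s, \<theta>) \<Rightarrow> (norm (g s))\<^sup>2 * (norm (f \<theta>))\<^sup>2)))"
      using K gf by (simp add: square_integrable_def)
    show "AE p in M1 \<Otimes>\<^sub>M M2. norm (J p) \<le>
        norm (c * ((norm (K p))\<^sup>2 + (case p of (s, \<theta>) \<Rightarrow> (norm (g s))\<^sup>2 * (norm (f \<theta>))\<^sup>2)))"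
    proof (rule AE_I2, clarify)
      fix s \<theta>
      let ?k = "norm (K (s, \<theta>))" and ?u = "norm (g s) * norm (f \<theta>)"
      have "\<bar>prod (K (s, \<theta>)) (f \<theta>) \<bullet> g s\<bar> \<le> norm (prod (K (s, \<theta>)) (f \<theta>)) * norm (g s)"
        by (rule Cauchy_Schwarz_ineq2)
      also have "\<dots> \<le> (?k * norm (f \<theta>) * c) * norm (g s)"
        by (intro mult_right_mono c) simp
      also have "\<dots> = c * (?k * ?u)" by simp
      also have "\<dots> \<le> c * (?k\<^sup>2 + ?u\<^sup>2)"
        using c(1) by (intro mult_left_mono mult_le_sum_squares) auto
      finally show "norm (J (s, \<theta>)) \<le>
          norm (c * (?k\<^sup>2 + (norm (g s))\<^sup>2 * (norm (f \<theta>))\<^sup>2))"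
        using c(1) by (simp add: J_def power_mult_distrib)
    qed
  qed measurable
  have "(\<integral>s. (\<integral>\<theta>. prod (K (s, \<theta>)) (f \<theta>) \<partial>M2) \<bullet> g s \<partial>M1) = (\<integral>s. (\<integral>\<theta>. J (s, \<theta>) \<partial>M2) \<partial>M1)"
  proof (rule integral_cong_AE)
    show "AE s in M1. (\<integral>\<theta>. prod (K (s, \<theta>)) (f \<theta>) \<partial>M2) \<bullet> g s = (\<integral>\<theta>. J (s, \<theta>) \<partial>M2)"
      using integrable_kernel_section by eventually_elim (simp add: J_def)
  qed measurable
  also have "\<dots> = (\<integral>\<theta>. (\<integral>s. J (s, \<theta>) \<partial>M1) \<partial>M2)"
    using Fubini_integral[of "\<lambda>s \<theta>. J (s, \<theta>)"] J by simp
  also have "\<dots> = (\<integral>\<theta>. f \<theta> \<bullet> (\<integral>s. prod' (K (s, \<theta>)) (g s) \<partial>M1) \<partial>M2)"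
  proof (rule integral_cong_AE)
    show "AE \<theta> in M2. (\<integral>s. J (s, \<theta>) \<partial>M1) = f \<theta> \<bullet> (\<integral>s. prod' (K (s, \<theta>)) (g s) \<partial>M1)"
      using section' by eventually_elim (simp add: J_def prod'(2))
  qed measurable
  finally show ?thesis .
qed

end

end

lemma formal_adjoints_kernel_operator:
  fixes K :: "'s \<times> 's \<Rightarrow> real^'n^'m"
  assumes M: "sigma_finite_measure M" and K: "square_integrable (M \<Otimes>\<^sub>M M) K"
  shows "formal_adjoints M (\<lambda>f s. \<integral>\<theta>. K (s, \<theta>) *v f \<theta> \<partial>M) (\<lambda>g \<theta>. \<integral>s. g s v* K (s, \<theta>) \<partial>M)"
proof -
  interpret pair_sigma_finite M M
    using M by (simp add: pair_sigma_finite_def)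
  have K': "square_integrable (M \<Otimes>\<^sub>M M) (\<lambda>(s, \<theta>). K (\<theta>, s))"
    using K integrable_product_swap[of "\<lambda>p. (norm (K p))\<^sup>2"] measurable_pair_swap[of K M M borel]
    by (simp add: square_integrable_def case_prod_beta' del: measurable_pair_swap_iff)
  note bil = bounded_bilinear_matrix_vector_mult bounded_bilinear_vector_matrix_mult
  show ?thesis
    unfolding formal_adjoints_def
    using square_integrable_kernel_operator[OF bil(1) K]
      square_integrable_kernel_operator[OF bil(2) K']
      integral_kernel_operator_inner[OF bil(1) K _ bil(2)]
      integrable_kernel_section[OF bil(2) K']
    by (simp add: inner_commute[of "_ *v _"] inner_commute[of _ "_ v* _"] dot_lmul_matrix)
qed

lemma formal_adjoints_multiplication_operator:
  fixes R :: "'s \<Rightarrow> real^'n^'m"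
  assumes R: "R \<in> borel_measurable M" and B: "AE s in M. norm (R s) \<le> B"
  shows "formal_adjoints M (\<lambda>f s. R s *v f s) (\<lambda>g s. g s v* R s)"
proof -
  have bound: "square_integrable M (\<lambda>s. prod (R s) (f s))"
    if bil: "bounded_bilinear prod" and f: "square_integrable M f"
    for f :: "'s \<Rightarrow> 'v::euclidean_space" and prod :: "real^'n^'m \<Rightarrow> 'v \<Rightarrow> 'w::euclidean_space"
  proof -
    interpret bounded_bilinear prod by (rule bil)
    obtain c where c: "c > 0" "\<And>k v. norm (prod k v) \<le> norm k * norm v * c"
      using pos_bounded by blast
    show ?thesis
    proof (rule square_integrable_if_norm_le[OF f])
      show "(\<lambda>s. prod (R s) (f s)) \<in> borel_measurable M"
        using R f by (intro borel_measurable_bounded_bilinear[OF bil]) (auto simp: square_integrable_def)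
      show "AE s in M. norm (prod (R s) (f s)) \<le> (B * c) * norm (f s)"
        using B
      proof eventually_elim
        case (elim s)
        have "norm (prod (R s) (f s)) \<le> norm (R s) * (norm (f s) * c)"
          using c(2)[of "R s" "f s"] by (simp add: mult_ac)
        also have "\<dots> \<le> B * (norm (f s) * c)"
          using elim c(1) by (intro mult_right_mono) auto
        finally show ?case by (simp add: mult_ac)
      qed
    qed
  qed
  show ?thesis
    unfolding formal_adjoints_def
    using bound[OF bounded_bilinear_matrix_vector_mult] bound[OF bounded_bilinear_vector_matrix_mult]
    by (simp add: inner_commute[of "_ *v _"] inner_commute[of _ "_ v* _"] dot_lmul_matrix)
qed

section \<open>Adjoints of partial integral operators\<close>

definition has_adjoint :: "('a::real_inner \<Rightarrow> 'b::real_inner) \<Rightarrow> bool"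
  where "has_adjoint F \<longleftrightarrow> (\<exists>G. \<forall>x y. F x \<bullet> y = x \<bullet> G y)"

text \<open>In infinite dimension the existence of an adjoint is a genuine hypothesis; given one, the
  identity determines it, and so pins down the choice made by \<^const>\<open>adjoint\<close>.\<close>
lemma inner_adjoint_right: "has_adjoint F \<Longrightarrow> x \<bullet> adjoint F y = F x \<bullet> y"
  by (metis adjoint_unique has_adjoint_def)

lemma has_adjoint_comp: "has_adjoint F \<Longrightarrow> has_adjoint G \<Longrightarrow> has_adjoint (F \<circ> G)"
  unfolding has_adjoint_def by (metis comp_apply)

lemma square_integrable_rep_L2: "square_integrable unit_measure (rep_L2 x)"
  using Quotient3_rep_reflp[OF Quotient3_L2, of x] by (simp add: L2_rel_def)

lemma inner_L2_eq_integral: "x \<bullet> y = (\<integral>s. rep_L2 x s \<bullet> rep_L2 y s \<partial>unit_measure)"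
  by (simp add: inner_L2_def)

lemma rep_abs_L2_AE:
  assumes "square_integrable unit_measure f"
  shows "AE s in unit_measure. rep_L2 (abs_L2 f) s = f s"
  using rep_abs_rsp_left[OF Quotient3_L2, of f f] assms by (simp add: L2_rel_def)

lemma has_adjoint_if_formal_adjoints:
  fixes P :: "'m::finite L2 \<Rightarrow> 'm L2"
  assumes FG: "formal_adjoints unit_measure F G"
    and P: "\<And>x. AE s in unit_measure. rep_L2 (P x) s = F (rep_L2 x) s"
  shows "has_adjoint P"
  unfolding has_adjoint_def
proof (intro exI allI)
  fix x y :: "'m L2"
  note sq = square_integrable_rep_L2
  have F: "square_integrable unit_measure (F (rep_L2 x))"
    and G: "square_integrable unit_measure (G (rep_L2 y))"
    using FG sq by (auto simp: formal_adjoints_def)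
  have [measurable]: "rep_L2 z \<in> borel_measurable unit_measure" for z :: "'m L2"
    using sq by (auto simp: square_integrable_def)
  have [measurable]: "F (rep_L2 x) \<in> borel_measurable unit_measure" "G (rep_L2 y) \<in> borel_measurable unit_measure"
    using F G by (auto simp: square_integrable_def)
  have "P x \<bullet> y = (\<integral>s. F (rep_L2 x) s \<bullet> rep_L2 y s \<partial>unit_measure)"
    unfolding inner_L2_eq_integral using P[of x] by (intro integral_cong_AE) auto
  also have "\<dots> = (\<integral>s. rep_L2 x s \<bullet> G (rep_L2 y) s \<partial>unit_measure)"
    using FG sq unfolding formal_adjoints_def by blast
  also have "\<dots> = x \<bullet> abs_L2 (G (rep_L2 y))"
    unfolding inner_L2_eq_integral using rep_abs_L2_AE[OF G] by (intro integral_cong_AE) auto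
  finally show "P x \<bullet> y = x \<bullet> abs_L2 (G (rep_L2 y))" .
qed

text \<open>
  Cutting a kernel off outside a triangle turns the integrals over \<open>{0..s}\<close> and \<open>{s..1}\<close> into integrals
  over the whole unit interval, to which the general result on integral operators applies.
\<close>
lemma square_integrable_truncated_kernel:
  fixes R :: "real \<Rightarrow> real \<Rightarrow> 'k::euclidean_space"
  assumes R: "square_integrable (unit_measure \<Otimes>\<^sub>M unit_measure) (\<lambda>(s, \<theta>). R s \<theta>)"
    and D: "Measurable.pred (borel \<Otimes>\<^sub>M borel) D"
  shows "square_integrable (unit_measure \<Otimes>\<^sub>M unit_measure)
    (\<lambda>(s, \<theta>). if D (s, \<theta>) then R s \<theta> else 0)"
proof (rule square_integrable_if_norm_le[OF R])
  have [measurable]: "(\<lambda>(s, \<theta>). R s \<theta>) \<in> borel_measurable (unit_measure \<Otimes>\<^sub>M unit_measure)"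
    using R by (simp add: square_integrable_def)
  have id: "(\<lambda>p. p) \<in> unit_measure \<Otimes>\<^sub>M unit_measure \<rightarrow>\<^sub>M borel \<Otimes>\<^sub>M (borel :: real measure)"
  proof (rule measurable_pair)
    have "(\<lambda>s. s) \<in> unit_measure \<rightarrow>\<^sub>M (borel :: real measure)"
      by (rule measurable_restrict_space1) simp
    from measurable_compose[OF measurable_fst this] measurable_compose[OF measurable_snd this]
    show "fst \<circ> (\<lambda>p. p) \<in> unit_measure \<Otimes>\<^sub>M unit_measure \<rightarrow>\<^sub>M (borel :: real measure)"
      "snd \<circ> (\<lambda>p. p) \<in> unit_measure \<Otimes>\<^sub>M unit_measure \<rightarrow>\<^sub>M (borel :: real measure)"
      by (simp_all add: comp_def)
  qed
  have [measurable]: "Measurable.pred (unit_measure \<Otimes>\<^sub>M unit_measure) D"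
    using measurable_compose[OF id D] by simp
  show "(\<lambda>(s, \<theta>). if D (s, \<theta>) then R s \<theta> else 0) \<in> borel_measurable (unit_measure \<Otimes>\<^sub>M unit_measure)"
    unfolding case_prod_beta by measurable
  show "AE p in unit_measure \<Otimes>\<^sub>M unit_measure.
      norm (case p of (s, \<theta>) \<Rightarrow> if D (s, \<theta>) then R s \<theta> else 0) \<le> 1 * norm (case p of (s, \<theta>) \<Rightarrow> R s \<theta>)"
    by (rule AE_I2) auto
qed

lemma PI_operator_has_adjoint:
  fixes P :: "'m::finite L2 \<Rightarrow> 'm L2"
  assumes "P \<in> \<Pi>\<^sub>3"
  shows "has_adjoint P"
proof -
  from assms obtain R0 :: "real \<Rightarrow> real^'m^'m" and R1 R2 :: "real \<Rightarrow> real \<Rightarrow> real^'m^'m" and B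
    where R0: "R0 \<in> borel_measurable unit_measure" "AE s in unit_measure. norm (R0 s) \<le> B"
      and R1: "square_integrable (unit_measure \<Otimes>\<^sub>M unit_measure) (\<lambda>(s, \<theta>). R1 s \<theta>)"
      and R2: "square_integrable (unit_measure \<Otimes>\<^sub>M unit_measure) (\<lambda>(s, \<theta>). R2 s \<theta>)"
      and P: "\<And>x. AE s in unit_measure.
        rep_L2 (P x) s = R0 s *v rep_L2 x s
          + (LINT \<theta>:{0..s}|lborel. R1 s \<theta> *v rep_L2 x \<theta>)
          + (LINT \<theta>:{s..1}|lborel. R2 s \<theta> *v rep_L2 x \<theta>)"
    unfolding PI_operators_def by blast
  define K1 K2 where "K1 = (\<lambda>(s, \<theta>). if \<theta> \<le> s then R1 s \<theta> else 0)"
    and "K2 = (\<lambda>(s, \<theta>). if s \<le> \<theta> then R2 s \<theta> else 0)"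
  have K1: "square_integrable (unit_measure \<Otimes>\<^sub>M unit_measure) K1"
    using square_integrable_truncated_kernel[OF R1, of "\<lambda>p. snd p \<le> fst p"] by (simp add: K1_def)
  have K2: "square_integrable (unit_measure \<Otimes>\<^sub>M unit_measure) K2"
    using square_integrable_truncated_kernel[OF R2, of "\<lambda>p. fst p \<le> snd p"] by (simp add: K2_def)
  have sigma: "sigma_finite_measure unit_measure"
    by (rule sigma_finite_measure_restrict_space[OF lborel.sigma_finite_measure_axioms]) simp
  show ?thesis
  proof (rule has_adjoint_if_formal_adjoints)
    show "formal_adjoints unit_measure
        (\<lambda>f s. R0 s *v f s + (\<integral>\<theta>. K1 (s, \<theta>) *v f \<theta> \<partial>unit_measure) + (\<integral>\<theta>. K2 (s, \<theta>) *v f \<theta> \<partial>unit_measure))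
        (\<lambda>g \<theta>. g \<theta> v* R0 \<theta> + (\<integral>s. g s v* K1 (s, \<theta>) \<partial>unit_measure) + (\<integral>s. g s v* K2 (s, \<theta>) \<partial>unit_measure))"
      by (intro formal_adjoints_add formal_adjoints_multiplication_operator[OF R0]
          formal_adjoints_kernel_operator[OF sigma K1] formal_adjoints_kernel_operator[OF sigma K2])
    fix x
    show "AE s in unit_measure. rep_L2 (P x) s =
        R0 s *v rep_L2 x s + (\<integral>\<theta>. K1 (s, \<theta>) *v rep_L2 x \<theta> \<partial>unit_measure)
          + (\<integral>\<theta>. K2 (s, \<theta>) *v rep_L2 x \<theta> \<partial>unit_measure)"
      using P[of x] AE_space
    proof eventually_elim
      case (elim s)
      then have s: "0 \<le> s" "s \<le> 1" by (auto simp: space_restrict_space)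
      have "(LINT \<theta>:{0..s}|lborel. R1 s \<theta> *v rep_L2 x \<theta>) = (\<integral>\<theta>. K1 (s, \<theta>) *v rep_L2 x \<theta> \<partial>unit_measure)"
        "(LINT \<theta>:{s..1}|lborel. R2 s \<theta> *v rep_L2 x \<theta>) = (\<integral>\<theta>. K2 (s, \<theta>) *v rep_L2 x \<theta> \<partial>unit_measure)"
        unfolding set_lebesgue_integral_def
        using s by (auto simp: integral_restrict_space K1_def K2_def indicator_def
            intro!: Bochner_Integration.integral_cong)
      with elim(1) show ?case by simp
    qed
  qed
qed

section \<open>Decay of quadratic Lyapunov functionals\<close>

text \<open>This differential form of Gronwall's inequality holds because \<open>exp(\<alpha>t) V(t)\<close> has nonpositive
  derivative.\<close>
lemma exp_decay_if_deriv_le: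
  fixes V :: "real \<Rightarrow> real"
  assumes V: "\<And>t. t \<ge> 0 \<Longrightarrow> (V has_real_derivative V' t) (at t within {0..})"
    and le: "\<And>t. t \<ge> 0 \<Longrightarrow> V' t \<le> - \<alpha> * V t" and t: "t \<ge> 0"
  shows "V t \<le> exp (- \<alpha> * t) * V 0"
proof -
  define W where "W = (\<lambda>t. exp (\<alpha> * t) * V t)"
  have W: "(W has_real_derivative exp (\<alpha> * r) * (V' r + \<alpha> * V r)) (at r within {0..})" if "r \<ge> 0" for r
    unfolding W_def by (auto intro!: derivative_eq_intros V[OF that] simp: algebra_simps)
  have "W t \<le> W 0"
  proof (rule DERIV_nonpos_imp_decreasing_open[OF t])
    fix r assume r: "0 < r" "r < t"
    then have "at r within {0..} = at r"
      by (intro at_within_interior) auto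
    then show "\<exists>y. (W has_real_derivative y) (at r) \<and> y \<le> 0"
      using W[of r] le[of r] r by (auto intro!: exI mult_nonneg_nonpos)
  next
    show "continuous_on {0..t} W"
      using W by (intro continuous_on_subset[OF DERIV_continuous_on[of "{0..}"]]) auto
  qed
  then show ?thesis
    by (simp add: W_def exp_minus field_simps)
qed

text \<open>Symmetry of \<open>M\<close> merges the two terms of the product rule into the single term on the left of
  the dissipation inequality.\<close>
lemma lyapunov_decay:
  fixes z :: "real \<Rightarrow> 'a::real_inner" and M :: "'a \<Rightarrow> 'a"
  assumes M: "bounded_linear M" and sym: "\<And>u v. M u \<bullet> v = u \<bullet> M v"
    and z: "\<And>t. t \<ge> 0 \<Longrightarrow> (z has_vector_derivative z' t) (at t within {0..})"
    and le: "\<And>t. t \<ge> 0 \<Longrightarrow> 2 * (z t \<bullet> M (z' t)) \<le> - \<alpha> * (z t \<bullet> M (z t))"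
    and t: "t \<ge> 0"
  shows "z t \<bullet> M (z t) \<le> exp (- \<alpha> * t) * (z 0 \<bullet> M (z 0))"
proof (rule exp_decay_if_deriv_le[where V = "\<lambda>t. z t \<bullet> M (z t)", OF _ le t])
  fix r :: real assume r: "r \<ge> 0"
  have "((\<lambda>t. z t \<bullet> M (z t)) has_vector_derivative z r \<bullet> M (z' r) + z' r \<bullet> M (z r)) (at r within {0..})"
    by (rule bounded_bilinear.has_vector_derivative[OF bounded_bilinear_inner z[OF r]
        bounded_linear.has_vector_derivative[OF M z[OF r]]])
  then show "((\<lambda>t. z t \<bullet> M (z t)) has_real_derivative 2 * (z r \<bullet> M (z' r))) (at r within {0..})"
    using sym[of "z r" "z' r"] by (simp add: has_real_derivative_iff_has_vector_derivative inner_commute)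
qed

lemma norm_exp_decay_if_square:
  fixes u :: "'a::real_normed_vector" and v :: "'b::real_normed_vector"
  assumes "\<epsilon> > 0" "B > 0" and le: "\<epsilon> * (norm u)\<^sup>2 \<le> exp (- \<alpha> * t) * (B * (norm v)\<^sup>2)"
  shows "norm u \<le> sqrt (B / \<epsilon>) * exp (- (\<alpha> / 2) * t) * norm v"
proof (rule power2_le_imp_le)
  have "(exp (- (\<alpha> / 2) * t))\<^sup>2 = exp (- \<alpha> * t)"
    by (simp flip: exp_double)
  then have "(sqrt (B / \<epsilon>) * exp (- (\<alpha> / 2) * t) * norm v)\<^sup>2 = exp (- \<alpha> * t) * (B * (norm v)\<^sup>2) / \<epsilon>"
    using assms(1,2) by (simp add: power_mult_distrib)
  then show "(norm u)\<^sup>2 \<le> (sqrt (B / \<epsilon>) * exp (- (\<alpha> / 2) * t) * norm v)\<^sup>2"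
    using divide_right_mono[OF le, of \<epsilon>] assms(1) by simp
qed (use assms in auto)

lemma bounded_linear_quadratic_bound:
  fixes M :: "'a::real_inner \<Rightarrow> 'a"
  assumes "bounded_linear M"
  obtains B where "B > 0" "\<And>x. x \<bullet> M x \<le> B * (norm x)\<^sup>2"
proof -
  obtain B where B: "B > 0" "\<And>x. norm (M x) \<le> norm x * B"
    using bounded_linear.pos_bounded[OF assms] by blast
  have "x \<bullet> M x \<le> B * (norm x)\<^sup>2" for x
  proof -
    have "x \<bullet> M x \<le> norm x * norm (M x)" by (rule norm_cauchy_schwarz)
    also have "\<dots> \<le> norm x * (norm x * B)" by (intro mult_left_mono B) simp
    finally show ?thesis by (simp add: power2_eq_square mult_ac)
  qed
  with B(1) that show ?thesis by blast
qed

section \<open>Lyapunov functionals along solutions\<close>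

lemma PIE_solution_vector_derivative:
  assumes "PIE_solution T A x"
  obtains x' where "\<And>t. t \<ge> 0 \<Longrightarrow> (x has_vector_derivative x' t) (at t within {0..})"
    and "\<And>t. t \<ge> 0 \<Longrightarrow> T (x' t) = A (x t)"
proof (rule that)
  show "(x has_vector_derivative vector_derivative x (at t within {0..})) (at t within {0..})" if "t \<ge> 0" for t
    using assms that by (simp add: PIE_solution_def differentiable_on_def flip: vector_derivative_works)
  show "T (vector_derivative x (at t within {0..})) = A (x t)" if "t \<ge> 0" for t
    using assms that by (simp add: PIE_solution_def)
qed

lemma self_adjoint_symmetric:
  assumes "has_adjoint M" "M = adjoint M"
  shows "M x \<bullet> y = x \<bullet> M y"
  using inner_adjoint_right[OF assms(1)] assms(2) by metis

text \<open>
  Here the weight \<open>Q \<circ> T\<close> is applied to \<open>x\<close> itself. The differential equation enters only through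
  \<open>Q (T x') = Q (A x)\<close>, so the derivative of \<open>x\<close>, on which there is no direct information, disappears.
\<close>
lemma PIE_state_lyapunov_decay:
  fixes T A Q :: "'a::real_inner \<Rightarrow> 'a"
  assumes QT: "bounded_linear (Q \<circ> T)"
    and adj: "has_adjoint A" "has_adjoint Q" "has_adjoint T"
    and sa: "Q \<circ> T = adjoint (Q \<circ> T)"
    and le: "(\<lambda>x. (Q \<circ> A) x + (adjoint A \<circ> adjoint Q) x) \<preceq> (\<lambda>x. - \<alpha> *\<^sub>R (Q \<circ> T) x)"
    and x: "PIE_solution T A x" and t: "t \<ge> 0"
  shows "x t \<bullet> Q (T (x t)) \<le> exp (- \<alpha> * t) * (x 0 \<bullet> Q (T (x 0)))"
proof -
  obtain x' where x': "\<And>t. t \<ge> 0 \<Longrightarrow> (x has_vector_derivative x' t) (at t within {0..})"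
    "\<And>t. t \<ge> 0 \<Longrightarrow> T (x' t) = A (x t)"
    using PIE_solution_vector_derivative[OF x] by blast
  \<comment> \<open>The two summands \<open>QA\<close> and \<open>A\<^sup>*Q\<^sup>*\<close> are adjoint to each other, so they have the same quadratic form.\<close>
  have "2 * (v \<bullet> Q (A v)) \<le> - \<alpha> * (v \<bullet> Q (T v))" for v
    using le unfolding op_le_def
    by (auto dest!: spec[of _ v] simp: inner_add_right inner_adjoint_right adj inner_commute)
  then have "2 * (x r \<bullet> (Q \<circ> T) (x' r)) \<le> - \<alpha> * (x r \<bullet> (Q \<circ> T) (x r))" if "r \<ge> 0" for r
    using x'(2)[OF that] by simp
  from lyapunov_decay[OF QT self_adjoint_symmetric[OF has_adjoint_comp[OF adj(2,3)] sa] x'(1) this t]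
  show ?thesis by simp
qed

text \<open>
  Here the weight \<open>P\<close> is applied to \<open>z = T x\<close>. Since \<open>T\<close> is bounded and linear, \<open>z' = T x' = A x\<close>, and
  pairing the operator inequality with \<open>x\<close> moves both outer adjoints onto \<open>x\<close>.
\<close>
lemma PDE_state_lyapunov_decay:
  fixes T A P :: "'a::real_inner \<Rightarrow> 'a"
  assumes T: "bounded_linear T" and P: "bounded_linear P"
    and adj: "has_adjoint A" "has_adjoint P" "has_adjoint T"
    and sa: "P = adjoint P"
    and le: "(\<lambda>x. (adjoint T \<circ> P \<circ> A) x + (adjoint A \<circ> P \<circ> T) x)
          \<preceq> (\<lambda>x. - \<alpha> *\<^sub>R (adjoint T \<circ> P \<circ> T) x)"
    and x: "PIE_solution T A x" and t: "t \<ge> 0"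
  shows "T (x t) \<bullet> P (T (x t)) \<le> exp (- \<alpha> * t) * (T (x 0) \<bullet> P (T (x 0)))"
proof -
  obtain x' where x': "\<And>t. t \<ge> 0 \<Longrightarrow> (x has_vector_derivative x' t) (at t within {0..})"
    "\<And>t. t \<ge> 0 \<Longrightarrow> T (x' t) = A (x t)"
    using PIE_solution_vector_derivative[OF x] by blast
  have z: "((\<lambda>t. T (x t)) has_vector_derivative A (x t)) (at t within {0..})" if "t \<ge> 0" for t
    using bounded_linear.has_vector_derivative[OF T x'(1)[OF that]] x'(2)[OF that] by simp
  note sym = self_adjoint_symmetric[OF adj(2) sa]
  have "2 * (T v \<bullet> P (A v)) \<le> - \<alpha> * (T v \<bullet> P (T v))" for v
    using le sym[of "T v" "A v"] unfolding op_le_def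
    by (auto dest!: spec[of _ v] simp: inner_add_right inner_adjoint_right adj inner_commute)
  from lyapunov_decay[OF P sym z this t] show ?thesis .
qed

section \<open>Stability criteria\<close>

theorem lemma8:
  fixes T A :: "'m::finite L2 \<Rightarrow> 'm L2"
  assumes "T \<in> \<Pi>\<^sub>3" and "A \<in> \<Pi>\<^sub>3"
  shows
    "((\<exists>Q\<in>\<Pi>\<^sub>3. \<exists>\<epsilon>>0. \<exists>\<alpha>>0.
        Q \<circ> T = adjoint (Q \<circ> T) \<and>
        (\<lambda>x. \<epsilon> *\<^sub>R (adjoint T \<circ> T) x) \<preceq> Q \<circ> T \<and>
        (\<lambda>x. (Q \<circ> A) x + (adjoint A \<circ> adjoint Q) x) \<preceq> (\<lambda>x. - \<alpha> *\<^sub>R (Q \<circ> T) x))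
      \<longrightarrow> exp_PIE_to_PDE_stable T A) \<and>
     ((\<exists>Q\<in>\<Pi>\<^sub>3. \<exists>\<epsilon>>0. \<exists>\<alpha>>0.
        Q \<circ> T = adjoint (Q \<circ> T) \<and>
        (\<lambda>x. \<epsilon> *\<^sub>R id x) \<preceq> Q \<circ> T \<and>
        (\<lambda>x. (Q \<circ> A) x + (adjoint A \<circ> adjoint Q) x) \<preceq> (\<lambda>x. - \<alpha> *\<^sub>R (Q \<circ> T) x))
      \<longrightarrow> exp_PIE_stable T A) \<and>
     ((\<exists>P\<in>\<Pi>\<^sub>3. \<exists>\<epsilon>>0. \<exists>\<alpha>>0.
        P = adjoint P \<and>
        (\<lambda>x. \<epsilon> *\<^sub>R id x) \<preceq> P \<and>
        (\<lambda>x. (adjoint T \<circ> P \<circ> A) x + (adjoint A \<circ> P \<circ> T) x)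
          \<preceq> (\<lambda>x. - \<alpha> *\<^sub>R (adjoint T \<circ> P \<circ> T) x))
      \<longrightarrow> exp_PDE_stable T A) \<and>
     ((\<exists>Q\<in>\<Pi>\<^sub>3. \<exists>\<epsilon>>0. \<exists>C>0. \<exists>\<alpha>>0.
        Q \<circ> T = adjoint (Q \<circ> T) \<and>
        (\<lambda>x. \<epsilon> *\<^sub>R id x) \<preceq> Q \<circ> T \<and>
        Q \<circ> T \<preceq> (\<lambda>x. C *\<^sub>R (adjoint T \<circ> T) x) \<and>
        (\<lambda>x. (Q \<circ> A) x + (adjoint A \<circ> adjoint Q) x) \<preceq> (\<lambda>x. - \<alpha> *\<^sub>R (Q \<circ> T) x))
      \<longrightarrow> exp_PDE_to_PIE_stable T A)"
proof -
  have bl: "bounded_linear R" if "R \<in> \<Pi>\<^sub>3" for R :: "'m L2 \<Rightarrow> 'm L2"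
    using that by (simp add: PI_operators_def)
  note adj = PI_operator_has_adjoint
  have QT: "bounded_linear (Q \<circ> T)" if "Q \<in> \<Pi>\<^sub>3" for Q
    using bounded_linear_compose[OF bl[OF that] bl[OF assms(1)]] by (simp add: comp_def)
  have TT: "x \<bullet> adjoint T (T x) = (norm (T x))\<^sup>2" for x
    by (simp add: inner_adjoint_right[OF adj[OF assms(1)]] power2_norm_eq_inner)
  note decay = PIE_state_lyapunov_decay[OF QT adj[OF assms(2)] adj adj[OF assms(1)]]
  show ?thesis
  proof (intro conjI impI; elim bexE exE conjE)
    fix Q \<epsilon> \<alpha>
    assume Q: "Q \<in> \<Pi>\<^sub>3" and pos: "\<epsilon> > 0" "\<alpha> > 0" and sa: "Q \<circ> T = adjoint (Q \<circ> T)"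
      and lower: "(\<lambda>x. \<epsilon> *\<^sub>R (adjoint T \<circ> T) x) \<preceq> Q \<circ> T"
      and le: "(\<lambda>x. (Q \<circ> A) x + (adjoint A \<circ> adjoint Q) x) \<preceq> (\<lambda>x. - \<alpha> *\<^sub>R (Q \<circ> T) x)"
    obtain B where B: "B > 0" "\<And>x. x \<bullet> (Q \<circ> T) x \<le> B * (norm x)\<^sup>2"
      using bounded_linear_quadratic_bound[OF QT[OF Q]] by blast
    have "norm (T (x t)) \<le> sqrt (B / \<epsilon>) * exp (- (\<alpha> / 2) * t) * norm (x 0)"
      if x: "PIE_solution T A x" and t: "t \<ge> 0" for x t
    proof (rule norm_exp_decay_if_square[OF pos(1) B(1)])
      have "\<epsilon> * (norm (T (x t)))\<^sup>2 \<le> x t \<bullet> Q (T (x t))"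
        using lower by (simp add: op_le_def TT)
      also have "\<dots> \<le> exp (- \<alpha> * t) * (x 0 \<bullet> Q (T (x 0)))"
        by (rule decay[OF Q Q sa le x t])
      also have "\<dots> \<le> exp (- \<alpha> * t) * (B * (norm (x 0))\<^sup>2)"
        using B(2)[of "x 0"] by (intro mult_left_mono) auto
      finally show "\<epsilon> * (norm (T (x t)))\<^sup>2 \<le> exp (- \<alpha> * t) * (B * (norm (x 0))\<^sup>2)" .
    qed
    with B(1) pos show "exp_PIE_to_PDE_stable T A"
      unfolding exp_PIE_to_PDE_stable_def
      by (intro exI[of _ "sqrt (B / \<epsilon>)"] exI[of _ "\<alpha> / 2"] conjI) auto
  next
    fix Q \<epsilon> \<alpha>
    assume Q: "Q \<in> \<Pi>\<^sub>3" and pos: "\<epsilon> > 0" "\<alpha> > 0" and sa: "Q \<circ> T = adjoint (Q \<circ> T)"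
      and lower: "(\<lambda>x. \<epsilon> *\<^sub>R id x) \<preceq> Q \<circ> T"
      and le: "(\<lambda>x. (Q \<circ> A) x + (adjoint A \<circ> adjoint Q) x) \<preceq> (\<lambda>x. - \<alpha> *\<^sub>R (Q \<circ> T) x)"
    obtain B where B: "B > 0" "\<And>x. x \<bullet> (Q \<circ> T) x \<le> B * (norm x)\<^sup>2"
      using bounded_linear_quadratic_bound[OF QT[OF Q]] by blast
    have "norm (x t) \<le> sqrt (B / \<epsilon>) * exp (- (\<alpha> / 2) * t) * norm (x 0)"
      if x: "PIE_solution T A x" and t: "t \<ge> 0" for x t
    proof (rule norm_exp_decay_if_square[OF pos(1) B(1)])
      have "\<epsilon> * (norm (x t))\<^sup>2 \<le> x t \<bullet> Q (T (x t))"
        using lower by (simp add: op_le_def power2_norm_eq_inner)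
      also have "\<dots> \<le> exp (- \<alpha> * t) * (x 0 \<bullet> Q (T (x 0)))"
        by (rule decay[OF Q Q sa le x t])
      also have "\<dots> \<le> exp (- \<alpha> * t) * (B * (norm (x 0))\<^sup>2)"
        using B(2)[of "x 0"] by (intro mult_left_mono) auto
      finally show "\<epsilon> * (norm (x t))\<^sup>2 \<le> exp (- \<alpha> * t) * (B * (norm (x 0))\<^sup>2)" .
    qed
    with B(1) pos show "exp_PIE_stable T A"
      unfolding exp_PIE_stable_def
      by (intro exI[of _ "sqrt (B / \<epsilon>)"] exI[of _ "\<alpha> / 2"] conjI) auto
  next
    fix P \<epsilon> \<alpha>
    assume P: "P \<in> \<Pi>\<^sub>3" and pos: "\<epsilon> > 0" "\<alpha> > 0" and sa: "P = adjoint P"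
      and lower: "(\<lambda>x. \<epsilon> *\<^sub>R id x) \<preceq> P"
      and le: "(\<lambda>x. (adjoint T \<circ> P \<circ> A) x + (adjoint A \<circ> P \<circ> T) x)
          \<preceq> (\<lambda>x. - \<alpha> *\<^sub>R (adjoint T \<circ> P \<circ> T) x)"
    obtain B where B: "B > 0" "\<And>x. x \<bullet> P x \<le> B * (norm x)\<^sup>2"
      using bounded_linear_quadratic_bound[OF bl[OF P]] by blast
    have "norm (T (x t)) \<le> sqrt (B / \<epsilon>) * exp (- (\<alpha> / 2) * t) * norm (T (x 0))"
      if x: "PIE_solution T A x" and t: "t \<ge> 0" for x t
    proof (rule norm_exp_decay_if_square[OF pos(1) B(1)])
      have "\<epsilon> * (norm (T (x t)))\<^sup>2 \<le> T (x t) \<bullet> P (T (x t))"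
        using lower by (simp add: op_le_def power2_norm_eq_inner)
      also have "\<dots> \<le> exp (- \<alpha> * t) * (T (x 0) \<bullet> P (T (x 0)))"
        by (rule PDE_state_lyapunov_decay[OF bl[OF assms(1)] bl[OF P] adj[OF assms(2)]
              adj[OF P] adj[OF assms(1)] sa le x t])
      also have "\<dots> \<le> exp (- \<alpha> * t) * (B * (norm (T (x 0)))\<^sup>2)"
        using B(2)[of "T (x 0)"] by (intro mult_left_mono) auto
      finally show "\<epsilon> * (norm (T (x t)))\<^sup>2 \<le> exp (- \<alpha> * t) * (B * (norm (T (x 0)))\<^sup>2)" .
    qed
    with B(1) pos show "exp_PDE_stable T A"
      unfolding exp_PDE_stable_def
      by (intro exI[of _ "sqrt (B / \<epsilon>)"] exI[of _ "\<alpha> / 2"] conjI) auto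
  next
    fix Q \<epsilon> C \<alpha>
    assume Q: "Q \<in> \<Pi>\<^sub>3" and pos: "\<epsilon> > 0" "C > 0" "\<alpha> > 0" and sa: "Q \<circ> T = adjoint (Q \<circ> T)"
      and lower: "(\<lambda>x. \<epsilon> *\<^sub>R id x) \<preceq> Q \<circ> T"
      and upper: "Q \<circ> T \<preceq> (\<lambda>x. C *\<^sub>R (adjoint T \<circ> T) x)"
      and le: "(\<lambda>x. (Q \<circ> A) x + (adjoint A \<circ> adjoint Q) x) \<preceq> (\<lambda>x. - \<alpha> *\<^sub>R (Q \<circ> T) x)"
    have "norm (x t) \<le> sqrt (C / \<epsilon>) * exp (- (\<alpha> / 2) * t) * norm (T (x 0))"
      if x: "PIE_solution T A x" and t: "t \<ge> 0" for x t
    proof (rule norm_exp_decay_if_square[OF pos(1,2)])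
      have "\<epsilon> * (norm (x t))\<^sup>2 \<le> x t \<bullet> Q (T (x t))"
        using lower by (simp add: op_le_def power2_norm_eq_inner)
      also have "\<dots> \<le> exp (- \<alpha> * t) * (x 0 \<bullet> Q (T (x 0)))"
        by (rule decay[OF Q Q sa le x t])
      also have "\<dots> \<le> exp (- \<alpha> * t) * (C * (norm (T (x 0)))\<^sup>2)"
        using upper by (intro mult_left_mono) (auto simp: op_le_def TT)
      finally show "\<epsilon> * (norm (x t))\<^sup>2 \<le> exp (- \<alpha> * t) * (C * (norm (T (x 0)))\<^sup>2)" .
    qed
    with pos show "exp_PDE_to_PIE_stable T A"
      unfolding exp_PDE_to_PIE_stable_def
      by (intro exI[of _ "sqrt (C / \<epsilon>)"] exI[of _ "\<alpha> / 2"] conjI) auto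
  qed
qed

end
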